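(* Let $V\ge 1$ be an integer, let $\Delta^V\subset\mathbb{R}^{V+1}$ be the probability simplex, and let $x$ be a random sample. For each sample $x$ let $\mathcal{L}_x:\Delta^V\to\mathbb{R}$ be a fusion loss, and assume that there is a constant $\mu>0$ such that, for each sample $x$, $\mathcal{L}_x$ is $\mu$-strongly convex on $\Delta^V$ (with respect to the Euclidean norm). Let $w^\star(x)=\arg\min_{w\in\Delta^V}\mathcal{L}_x(w)$ be the oracle routing rule, let $s(x)$ be a statistic of $x$ (the branch-local statistics), and let $$\mathcal{W}_{\mathrm{local}}=\{\,w(\cdot)\;:\;w(x)=\psi(s(x))\text{ for some measurable }\Delta^V\text{-valued function }\psi\,\}$$ be the class of branch-local self-weighting rules. Then $$\inf_{w\in\mathcal{W}_{\mathrm{local}}}\mathbb{E}\big[\mathcal{L}_x(w(x))\big]-\mathbb{E}\big[\mathcal{L}_x(w^\star(x))\big]\;\ge\;\frac{\mu}{2}\,\mathbb{E}\Big[\mathrm{Var}\big(w^\star(x)\mid s(x)\big)\Big].$$ In particular, if $w^\star(x)$ is not recoverable from $s(x)$, i.e. $w^\star(x)$ is not almost surely equal to any measurable function of $s(x)$, then the left-hand side is strictly positive, so that every branch-local self-weighting rule incurs a strictly positive irreducible excess risk.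
   Context: There are $V+1$ experts, and $\Delta^V=\{w\in\mathbb{R}^{V+1}: w_i\ge 0,\ \sum_{i=1}^{V+1}w_i=1\}$ is the set of expert-weight vectors. All expectations are over the random sample $x$. A function $f:\Delta^V\to\mathbb{R}$ is $\mu$-strongly convex if $f((1-t)a+tb)\le(1-t)f(a)+t f(b)-\frac{\mu}{2}t(1-t)\|a-b\|_2^2$ for all $a,b\in\Delta^V$ and $t\in[0,1]$ (no differentiability is assumed). For the vector-valued oracle, the conditional variance denotes the trace of the conditional covariance: $$\mathrm{Var}\big(w^\star(x)\mid s(x)\big)=\mathbb{E}\Big[\big\|w^\star(x)-\mathbb{E}[w^\star(x)\mid s(x)]\big\|_2^2\;\Big|\;s(x)\Big].$$ Implicit conventions: for each $x$ the minimizer $w^\star(x)$ exists (it is then unique by strong convexity, and it may lie on the boundary of the simplex); $s(x)$ and $w^\star(x)$ are measurable, and $x\mapsto\mathcal{L}_x(w(x))$ is measurable for every measurable $\Delta^V$-valued rule $w$; and $\mathbb{E}[\mathcal{L}_x(w^\star(x))]$ is finite. For any local rule, $\mathbb{E}[\mathcal{L}_x(w(x))]$ is then well defined in $(-\infty,+\infty]$. *)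

theory Defs
  imports "HOL-Probability.Probability"
begin

definition prob_simplex :: "(real ^ 'n) set" where
  "prob_simplex = {w. (\<forall>i. 0 \<le> w $ i) \<and> (\<Sum>i\<in>UNIV. w $ i) = 1}"

definition strongly_convex_on :: "'v::real_inner set \<Rightarrow> real \<Rightarrow> ('v \<Rightarrow> real) \<Rightarrow> bool" where
  "strongly_convex_on S \<mu> f \<longleftrightarrow>
     (\<forall>a\<in>S. \<forall>b\<in>S. \<forall>t\<in>{0..1}.
        f ((1 - t) *\<^sub>R a + t *\<^sub>R b)
          \<le> (1 - t) * f a + t * f b - \<mu> / 2 * t * (1 - t) * (norm (a - b))\<^sup>2)"

text \<open>
  The expectation with values in the extended reals, as the expectation of the positive part minus
  that of the negative part.  Unlike the Bochner integral, which is 0 for a non-integrable function,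
  it is \<open>\<infinity>\<close> when only the positive part has infinite expectation.
\<close>

definition ext_expectation :: "'a measure \<Rightarrow> ('a \<Rightarrow> real) \<Rightarrow> ereal" where
  "ext_expectation M f =
     enn2ereal (\<integral>\<^sup>+ x. ennreal (f x) \<partial>M) - enn2ereal (\<integral>\<^sup>+ x. ennreal (- f x) \<partial>M)"

lemma ext_expectation_eq_integral:
  assumes "integrable M f"
  shows "ext_expectation M f = ereal (integral\<^sup>L M f)"
proof -
  have fin: "(\<integral>\<^sup>+ x. ennreal (f x) \<partial>M) \<noteq> \<infinity>" "(\<integral>\<^sup>+ x. ennreal (- f x) \<partial>M) \<noteq> \<infinity>"
    using assms by (auto simp: real_integrable_def)
  have *: "enn2ereal e = ereal (enn2real e)" if "e \<noteq> \<infinity>" for e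
    using that by (cases e) auto
  show ?thesis
    unfolding ext_expectation_def real_lebesgue_integral_def[OF assms]
    using fin by (simp add: *)
qed

definition local_rules :: "'b measure \<Rightarrow> ('a \<Rightarrow> 'b) \<Rightarrow> ('a \<Rightarrow> real ^ 'n) set" where
  "local_rules N s = {\<lambda>x. \<psi> (s x) |\<psi>. \<psi> \<in> N \<rightarrow>\<^sub>M restrict_space borel prob_simplex}"

text \<open>
  Conditioning on \<open>s\<close> means conditioning on the \<open>\<sigma>\<close>-algebra on \<open>space M\<close> generated by \<open>s\<close>.
  The conditional expectation of a vector is taken componentwise.
\<close>

definition vec_cond_exp ::
    "'a measure \<Rightarrow> 'b measure \<Rightarrow> ('a \<Rightarrow> 'b) \<Rightarrow> ('a \<Rightarrow> real ^ 'n) \<Rightarrow> 'a \<Rightarrow> real ^ 'n" where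
  "vec_cond_exp M N s f =
     (\<lambda>x. \<chi> i. real_cond_exp M (vimage_algebra (space M) s N) (\<lambda>y. f y $ i) x)"

definition cond_variance ::
    "'a measure \<Rightarrow> 'b measure \<Rightarrow> ('a \<Rightarrow> 'b) \<Rightarrow> ('a \<Rightarrow> real ^ 'n) \<Rightarrow> 'a \<Rightarrow> real" where
  "cond_variance M N s f =
     real_cond_exp M (vimage_algebra (space M) s N)
       (\<lambda>x. (norm (f x - vec_cond_exp M N s f x))\<^sup>2)"

end

theory Submission
  imports Defs
begin

text \<open>
  Strong convexity, tested along the segment from the minimizer \<open>wstar x\<close> to \<open>w\<close> and divided by the
  parameter \<open>t \<rightarrow> 0\<close>, gives the quadratic growth
  \<open>L x w - L x (wstar x) \<ge> \<mu> / 2 * \<parallel>w - wstar x\<parallel>\<^sup>2\<close>, also when the minimizer lies on the boundary.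
  A local rule is measurable with respect to the \<open>\<sigma>\<close>-algebra generated by \<open>s\<close>, so its mean squared
  distance to \<open>wstar\<close> is at least that of the conditional expectation of \<open>wstar\<close>, which is the
  expected conditional variance.  If the latter vanishes, \<open>wstar\<close> is almost surely its conditional
  expectation and hence, by the Doob--Dynkin lemma, a measurable function of \<open>s\<close>.
\<close>

section \<open>Quadratic growth at a constrained minimizer, and the simplex\<close>

lemma is_arg_min_strongly_convex_on_growth:
  fixes f :: "'v::real_inner \<Rightarrow> real"
  assumes "convex S" and sc: "strongly_convex_on S \<mu> f"
    and min: "is_arg_min f (\<lambda>w. w \<in> S) a" and b: "b \<in> S"
  shows "\<mu> / 2 * (norm (b - a))\<^sup>2 \<le> f b - f a"
proof -
  have a: "a \<in> S" and le: "f a \<le> f w" if "w \<in> S" for w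
    using min that by (auto simp: is_arg_min_linorder)
  let ?d = "\<mu> / 2 * (norm (b - a))\<^sup>2"
  have ineq: "(1 - t) * ?d \<le> f b - f a" if t: "0 < t" "t \<le> 1" for t
  proof -
    have "f a \<le> f ((1 - t) *\<^sub>R a + t *\<^sub>R b)"
      using le[OF convexD_alt[OF \<open>convex S\<close> a[OF b] b]] t by simp
    also have "\<dots> \<le> (1 - t) * f a + t * f b - \<mu> / 2 * t * (1 - t) * (norm (a - b))\<^sup>2"
      using sc a[OF b] b t unfolding strongly_convex_on_def by auto
    finally have "t * ((1 - t) * ?d) \<le> t * (f b - f a)"
      by (simp add: algebra_simps norm_minus_commute)
    then show ?thesis
      using t by simp
  qed
  have "((\<lambda>t. (1 - t) * ?d) \<longlongrightarrow> (1 - 0) * ?d) (at_right 0)"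
    by (intro tendsto_intros)
  moreover have "\<forall>\<^sub>F t in at_right 0. (1 - t) * ?d \<le> f b - f a"
    unfolding eventually_at_right_field using ineq by (intro exI[of _ 1]) auto
  ultimately have "(1 - 0) * ?d \<le> f b - f a"
    by (rule tendsto_upperbound) simp
  then show ?thesis
    by simp
qed

lemma convex_prob_simplex: "convex (prob_simplex :: (real ^ 'n) set)"
  by (auto simp: convex_def prob_simplex_def sum.distrib simp flip: sum_distrib_left)

lemma prob_simplex_component:
  fixes w :: "real ^ 'n"
  assumes "w \<in> prob_simplex"
  shows "\<bar>w $ i\<bar> \<le> 1"
proof -
  have "w $ i \<le> (\<Sum>j\<in>UNIV. w $ j)"
    using assms by (intro member_le_sum) (auto simp: prob_simplex_def)
  then show ?thesis
    using assms by (auto simp: prob_simplex_def)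
qed

text \<open>An integrable lower bound forces the negative part of \<open>g\<close> to have finite
  expectation. So if \<open>g\<close> fails to be integrable, its positive part has infinite
  expectation and the right-hand side is \<infinity>.\<close>

lemma integral_le_ext_expectation:
  assumes h: "integrable M h" and g: "g \<in> borel_measurable M" and le: "AE x in M. h x \<le> g x"
  shows "ereal (\<integral>x. h x \<partial>M) \<le> ext_expectation M g"
proof (cases "integrable M g")
  case True
  then show ?thesis
    using integral_mono_AE[OF h True le] by (simp add: ext_expectation_eq_integral)
next
  case False
  have "(\<integral>\<^sup>+ x. ennreal (- g x) \<partial>M) \<le> (\<integral>\<^sup>+ x. ennreal (- h x) \<partial>M)"
    using le by (intro nn_integral_mono_AE) (auto intro!: ennreal_leI)
  also have "\<dots> < \<infinity>"
    using h by (auto simp: real_integrable_def less_top)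
  finally have "(\<integral>\<^sup>+ x. ennreal (- g x) \<partial>M) \<noteq> \<infinity>"
    by simp
  then have "(\<integral>\<^sup>+ x. ennreal (g x) \<partial>M) = \<infinity>" "enn2ereal (\<integral>\<^sup>+ x. ennreal (- g x) \<partial>M) \<noteq> \<infinity>"
    using False g by (auto simp: real_integrable_def enn2ereal_eq_top_iff top_ereal_def)
  then have "ext_expectation M g = \<infinity>"
    by (simp add: ext_expectation_def)
  then show ?thesis
    by simp
qed

section \<open>Square-integrable functions and conditional expectation as a projection\<close>

lemma integrable_mult_of_square_integrable:
  fixes f g :: "'a \<Rightarrow> real"
  assumes [measurable]: "f \<in> borel_measurable M" "g \<in> borel_measurable M"
    and "integrable M (\<lambda>x. (f x)\<^sup>2)" "integrable M (\<lambda>x. (g x)\<^sup>2)"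
  shows "integrable M (\<lambda>x. f x * g x)"
proof (rule Bochner_Integration.integrable_bound)
  show "integrable M (\<lambda>x. (f x)\<^sup>2 + (g x)\<^sup>2)"
    using assms by simp
  have "\<bar>a * b\<bar> \<le> a\<^sup>2 + b\<^sup>2" for a b :: real
  proof -
    have "2 * \<bar>a * b\<bar> \<le> a\<^sup>2 + b\<^sup>2"
      using sum_squares_bound[of "\<bar>a\<bar>" "\<bar>b\<bar>"] by (simp add: abs_mult)
    then show ?thesis
      by linarith
  qed
  then show "AE x in M. norm (f x * g x) \<le> norm ((f x)\<^sup>2 + (g x)\<^sup>2)"
    by auto
qed simp

lemma integrable_square_diff:
  fixes f g :: "'a \<Rightarrow> real"
  assumes "f \<in> borel_measurable M" "g \<in> borel_measurable M"
    and "integrable M (\<lambda>x. (f x)\<^sup>2)" "integrable M (\<lambda>x. (g x)\<^sup>2)"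
  shows "integrable M (\<lambda>x. (f x - g x)\<^sup>2)"
proof -
  have "integrable M (\<lambda>x. (f x)\<^sup>2 + (g x)\<^sup>2 - 2 * (f x * g x))"
    using assms integrable_mult_of_square_integrable[OF assms]
    by (intro Bochner_Integration.integrable_diff Bochner_Integration.integrable_add
        integrable_mult_right)
  then show ?thesis
    by (simp add: power2_diff algebra_simps)
qed

context finite_measure_subalgebra
begin

lemma integrable_square_real_cond_exp:
  assumes "f \<in> borel_measurable M" "integrable M (\<lambda>x. (f x)\<^sup>2)"
  shows "integrable M (\<lambda>x. (real_cond_exp M F f x)\<^sup>2)"
  \<comment> \<open>Conditional Jensen for the square. The two \<open>undefined\<close> stand for
    interval endpoints, arbitrary when the interval is \<open>UNIV\<close>.\<close>
  using square_integrable_imp_integrable[OF assms]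
    integrable_convex_cond_exp[of f UNIV undefined undefined "\<lambda>x. x\<^sup>2"] assms(2)
  by (simp add: convex_power2)

text \<open>Pythagoras in L2: \<open>f - m\<close> is orthogonal to every square-integrable
  \<open>F\<close>-measurable function, in particular to \<open>d = m - g\<close>.\<close>

lemma real_cond_exp_minimizes_square_error:
  assumes f: "f \<in> borel_measurable M" "integrable M (\<lambda>x. (f x)\<^sup>2)"
    and g: "g \<in> borel_measurable F" "integrable M (\<lambda>x. (g x)\<^sup>2)"
  shows "(\<integral>x. (f x - real_cond_exp M F f x)\<^sup>2 \<partial>M) \<le> (\<integral>x. (f x - g x)\<^sup>2 \<partial>M)"
proof -
  define m where "m = real_cond_exp M F f"
  have mF: "m \<in> borel_measurable F" and mM: "m \<in> borel_measurable M"
    by (simp_all add: m_def)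
  have m2: "integrable M (\<lambda>x. (m x)\<^sup>2)"
    unfolding m_def by (rule integrable_square_real_cond_exp[OF f])
  have gM: "g \<in> borel_measurable M"
    by (rule measurable_from_subalg[OF subalg g(1)])
  define d where "d = (\<lambda>x. m x - g x)"
  have dF: "d \<in> borel_measurable F" and dM: "d \<in> borel_measurable M"
    using mF mM g(1) gM by (simp_all add: d_def)
  have d2: "integrable M (\<lambda>x. (d x)\<^sup>2)"
    unfolding d_def by (rule integrable_square_diff[OF mM gM m2 g(2)])
  have df: "integrable M (\<lambda>x. d x * f x)"
    by (rule integrable_mult_of_square_integrable[OF dM f(1) d2 f(2)])
  \<comment> \<open>The orthogonality: \<open>d\<close> is \<open>F\<close>-measurable, so
    \<open>f\<close> may be replaced by its conditional expectation in the product.\<close>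
  have dm: "integrable M (\<lambda>x. d x * m x)" "(\<integral>x. d x * m x \<partial>M) = (\<integral>x. d x * f x \<partial>M)"
    unfolding m_def using real_cond_exp_intg[OF df dF f(1)] by simp_all
  have fm: "integrable M (\<lambda>x. (f x - m x)\<^sup>2)"
    by (rule integrable_square_diff[OF f(1) mM f(2) m2])
  have "(\<integral>x. (f x - g x)\<^sup>2 \<partial>M)
      = (\<integral>x. (f x - m x)\<^sup>2 + (d x)\<^sup>2 + 2 * (d x * f x - d x * m x) \<partial>M)"
    by (simp add: d_def power2_eq_square algebra_simps)
  also have "\<dots> = (\<integral>x. (f x - m x)\<^sup>2 \<partial>M) + (\<integral>x. (d x)\<^sup>2 \<partial>M)"
    using fm d2 df dm by simp
  finally show ?thesis
    by (simp add: m_def)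
qed

end

section \<open>Factorization through the statistic (Doob-Dynkin)\<close>

text \<open>Sets of the generated algebra are preimages under \<open>s\<close>, so indicators
  factor; sums, scalings and monotone limits preserve this.\<close>

lemma Doob_Dynkin_ennreal:
  fixes u :: "'a \<Rightarrow> ennreal"
  assumes s: "s \<in> X \<rightarrow> space N" and u: "u \<in> borel_measurable (vimage_algebra X s N)"
  shows "\<exists>h\<in>borel_measurable N. \<forall>x\<in>X. u x = h (s x)"
  using u
proof (induction rule: borel_measurable_induct)
  case (cong f g)
  then show ?case by simp
next
  case (set A)
  then obtain B where "B \<in> sets N" "A = s -` B \<inter> X"
    using s by (auto simp: sets_vimage_algebra2)
  then show ?case
    by (intro bexI[of _ "indicator B"]) (auto simp: indicator_def)
next
  case (mult u c)
  then obtain h where [measurable]: "h \<in> borel_measurable N" and "\<forall>x\<in>X. u x = h (s x)"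
    by blast
  then show ?case
    by (intro bexI[of _ "\<lambda>y. c * h y"]) auto
next
  case (add u v)
  then obtain h k where [measurable]: "h \<in> borel_measurable N" "k \<in> borel_measurable N"
    and "\<forall>x\<in>X. u x = h (s x)" "\<forall>x\<in>X. v x = k (s x)"
    by blast
  then show ?case
    by (intro bexI[of _ "\<lambda>y. k y + h y"]) auto
next
  case (seq U)
  then obtain h where [measurable]: "\<And>i. h i \<in> borel_measurable N"
    and "\<And>i. \<forall>x\<in>X. U i x = h i (s x)"
    by metis
  \<comment> \<open>Off the image of \<open>s\<close> the \<open>h i\<close> need not increase, but
    in \<open>ennreal\<close> their supremum exists and is measurable anyway.\<close>
  then show ?case
    by (intro bexI[of _ "\<lambda>y. SUP i. h i y"]) (auto simp: image_comp)
qed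

lemma Doob_Dynkin_vec:
  fixes f :: "'a \<Rightarrow> real ^ 'n"
  assumes s: "s \<in> X \<rightarrow> space N"
    and f: "\<And>i. (\<lambda>x. f x $ i) \<in> borel_measurable (vimage_algebra X s N)"
  shows "\<exists>\<psi>\<in>borel_measurable N. \<forall>x\<in>X. f x = \<psi> (s x)"
proof -
  have "\<exists>h\<in>borel_measurable N. \<forall>x\<in>X. f x $ i = h (s x)" for i
  proof -
    obtain p q where [measurable]: "p \<in> borel_measurable N" "q \<in> borel_measurable N"
      and p: "\<forall>x\<in>X. ennreal (f x $ i) = p (s x)"
      and q: "\<forall>x\<in>X. ennreal (- (f x $ i)) = q (s x)"
      using Doob_Dynkin_ennreal[OF s, of "\<lambda>x. ennreal (f x $ i)"]
        Doob_Dynkin_ennreal[OF s, of "\<lambda>x. ennreal (- (f x $ i))"] f[of i]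
      by (metis borel_measurable_uminus measurable_compose measurable_ennreal)
    \<comment> \<open>\<open>ennreal\<close> sends negative reals to 0, so \<open>p\<close> and
      \<open>q\<close> represent the positive and negative parts of the coordinate.\<close>
    have "f x $ i = enn2real (p (s x)) - enn2real (q (s x))" if "x \<in> X" for x
      using p q that by (cases "0 \<le> f x $ i") (auto simp: ennreal_neg simp flip: p q)
    then show ?thesis
      by (intro bexI[of _ "\<lambda>y. enn2real (p y) - enn2real (q y)"]) auto
  qed
  then obtain h where h: "\<And>i. h i \<in> borel_measurable N" "\<And>i. \<forall>x\<in>X. f x $ i = h i (s x)"
    by metis
  have "(\<lambda>y. \<chi> i. h i y) \<in> borel_measurable N"
    using h(1) by (subst borel_measurable_euclidean_space)
      (auto simp: Basis_vec_def inner_axis)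
  then show ?thesis
    using h(2) by (intro bexI[of _ "\<lambda>y. \<chi> i. h i y"]) (auto simp: vec_eq_iff)
qed

section \<open>Excess risk of local rules\<close>

theorem theorem4p2:
  fixes V :: nat
    and D :: "'a measure"
    and N :: "'b measure"
    and L :: "'a \<Rightarrow> real ^ 'n \<Rightarrow> real"
    and \<mu> :: real
    and wstar :: "'a \<Rightarrow> real ^ 'n"
    and s :: "'a \<Rightarrow> 'b"
  assumes "V \<ge> 1"
    and "CARD('n) = V + 1"
    and "prob_space D"
    and "\<mu> > 0"
    and "\<And>x. x \<in> space D \<Longrightarrow> strongly_convex_on prob_simplex \<mu> (L x)"
    and "\<And>x. x \<in> space D \<Longrightarrow> is_arg_min (L x) (\<lambda>w. w \<in> prob_simplex) (wstar x)"
    and "s \<in> D \<rightarrow>\<^sub>M N"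
    and "wstar \<in> borel_measurable D"
    and "\<And>w. w \<in> D \<rightarrow>\<^sub>M restrict_space borel prob_simplex \<Longrightarrow>
           (\<lambda>x. L x (w x)) \<in> borel_measurable D"
    and "integrable D (\<lambda>x. L x (wstar x))"
  shows "(INF w\<in>local_rules N s. ext_expectation D (\<lambda>x. L x (w x)))
           - ext_expectation D (\<lambda>x. L x (wstar x))
         \<ge> ereal (\<mu> / 2 * (\<integral>x. cond_variance D N s wstar x \<partial>D))
       \<and> (\<not> (\<exists>\<psi>\<in>borel_measurable N. AE x in D. wstar x = \<psi> (s x)) \<longrightarrow>
           (INF w\<in>local_rules N s. ext_expectation D (\<lambda>x. L x (w x)))
             - ext_expectation D (\<lambda>x. L x (wstar x)) > 0
         \<and> (\<forall>w\<in>local_rules N s.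
              ext_expectation D (\<lambda>x. L x (w x)) - ext_expectation D (\<lambda>x. L x (wstar x)) > 0))"
proof -
  interpret prob_space D by fact
  note \<mu> = assms(4) and sc = assms(5) and min = assms(6) and s = assms(7)
    and ws = assms(8) and Lmeas = assms(9) and Lint = assms(10)
  define F where "F = vimage_algebra (space D) s N"
  have sF: "s \<in> F \<rightarrow>\<^sub>M N" and sX: "s \<in> space D \<rightarrow> space N"
    using measurable_space[OF s] by (auto simp: F_def intro!: measurable_vimage_algebra1)
  interpret finite_measure_subalgebra D F
    by unfold_locales
      (auto simp: subalgebra_def F_def intro!: sets_image_in_sets[OF refl s, THEN subsetD])
  define m where "m = vec_cond_exp D N s wstar"
  have m_nth: "m x $ i = real_cond_exp D F (\<lambda>y. wstar y $ i) x" for x i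
    by (simp add: m_def vec_cond_exp_def F_def)
  have wstar_in: "wstar x \<in> prob_simplex" if "x \<in> space D" for x
    using min[OF that] by (simp add: is_arg_min_linorder)
  have sq_int: "integrable D (\<lambda>x. (w x $ i)\<^sup>2)"
    if "w \<in> borel_measurable D" "\<And>x. x \<in> space D \<Longrightarrow> w x \<in> prob_simplex"
    for w :: "'a \<Rightarrow> real ^ 'n" and i
  proof (rule integrable_const_bound)
    show "AE x in D. norm ((w x $ i)\<^sup>2) \<le> 1"
      using that(2) prob_simplex_component[of _ i] by (intro AE_I2) (simp add: abs_square_le_1)
    show "(\<lambda>x. (w x $ i)\<^sup>2) \<in> borel_measurable D"
      by (rule borel_measurable_power[OF measurable_compose[OF that(1) borel_measurable_nth]])
  qed
  have ws_nth: "(\<lambda>x. wstar x $ i) \<in> borel_measurable D" for i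
    by (rule measurable_compose[OF ws borel_measurable_nth])
  \<comment> \<open>\<open>m\<close> is only a version of the conditional expectation and need not
    lie in the simplex everywhere, so its second moments come from Jensen instead of
    boundedness.\<close>
  have m_measF: "(\<lambda>x. m x $ i) \<in> borel_measurable F"
    and m_meas: "(\<lambda>x. m x $ i) \<in> borel_measurable D"
    and m_sq: "integrable D (\<lambda>x. (m x $ i)\<^sup>2)" for i
    unfolding m_nth using integrable_square_real_cond_exp[OF ws_nth sq_int[OF ws wstar_in]]
    by simp_all
  have norm_sum: "(norm v)\<^sup>2 = (\<Sum>i\<in>UNIV. (v $ i)\<^sup>2)" for v :: "real ^ 'n"
    unfolding power2_norm_eq_inner inner_vec_def by (simp add: power2_eq_square)
  have int_i: "integrable D (\<lambda>x. (wstar x $ i - m x $ i)\<^sup>2)" for i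
    by (rule integrable_square_diff[OF ws_nth m_meas sq_int[OF ws wstar_in] m_sq])
  then have int_m: "integrable D (\<lambda>x. (norm (wstar x - m x))\<^sup>2)"
    by (simp add: norm_sum)
  define c where "c = (\<integral>x. (norm (wstar x - m x))\<^sup>2 \<partial>D)"
  \<comment> \<open>Integrating a conditional expectation removes the conditioning.\<close>
  have cv: "(\<integral>x. cond_variance D N s wstar x \<partial>D) = c"
    using real_cond_exp_int(2)[OF int_m] by (simp add: cond_variance_def c_def m_def F_def)
  define e where "e = (\<integral>x. L x (wstar x) \<partial>D)"
  have e: "ext_expectation D (\<lambda>x. L x (wstar x)) = ereal e"
    using Lint by (simp add: e_def ext_expectation_eq_integral)

  have bound: "ereal (e + \<mu> / 2 * c) \<le> ext_expectation D (\<lambda>x. L x (w x))"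
    if "w \<in> local_rules N s" for w
  proof -
    from that obtain \<psi>
      where w: "w = (\<lambda>x. \<psi> (s x))" and \<psi>: "\<psi> \<in> N \<rightarrow>\<^sub>M restrict_space borel prob_simplex"
      unfolding local_rules_def mem_Collect_eq by (elim exE conjE)
    have wD: "w \<in> D \<rightarrow>\<^sub>M restrict_space borel prob_simplex"
      unfolding w by (rule measurable_compose[OF s \<psi>])
    then have w_in: "\<And>x. x \<in> space D \<Longrightarrow> w x \<in> prob_simplex" and w_meas: "w \<in> borel_measurable D"
      by (auto simp: measurable_restrict_space2_iff)
    have "\<psi> \<in> borel_measurable N"
      using \<psi> by (auto simp: measurable_restrict_space2_iff)
    then have "w \<in> borel_measurable F"
      unfolding w by (rule measurable_compose[OF sF])
    then have wF: "(\<lambda>x. w x $ i) \<in> borel_measurable F" for i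
      by (rule measurable_compose[OF _ borel_measurable_nth])
    have w_nth: "(\<lambda>x. w x $ i) \<in> borel_measurable D" for i
      by (rule measurable_compose[OF w_meas borel_measurable_nth])
    have int_wi: "integrable D (\<lambda>x. (wstar x $ i - w x $ i)\<^sup>2)" for i
      by (rule integrable_square_diff[OF ws_nth w_nth sq_int[OF ws wstar_in]
            sq_int[OF w_meas w_in]])
    then have int_w: "integrable D (\<lambda>x. (norm (wstar x - w x))\<^sup>2)"
      by (simp add: norm_sum)
    \<comment> \<open>The projection property is applied to each coordinate and then summed.\<close>
    have "(\<integral>x. (wstar x $ i - m x $ i)\<^sup>2 \<partial>D) \<le> (\<integral>x. (wstar x $ i - w x $ i)\<^sup>2 \<partial>D)" for i
      unfolding m_nth
      by (rule real_cond_exp_minimizes_square_error[OF ws_nth sq_int[OF ws wstar_in] wF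
            sq_int[OF w_meas w_in]])
    then have "c \<le> (\<integral>x. (norm (wstar x - w x))\<^sup>2 \<partial>D)"
      using int_i int_wi by (simp add: c_def norm_sum sum_mono)
    then have "e + \<mu> / 2 * c \<le> (\<integral>x. L x (wstar x) + \<mu> / 2 * (norm (wstar x - w x))\<^sup>2 \<partial>D)"
      using \<mu> Lint int_w by (simp add: e_def)
    then have "ereal (e + \<mu> / 2 * c)
        \<le> ereal (\<integral>x. L x (wstar x) + \<mu> / 2 * (norm (wstar x - w x))\<^sup>2 \<partial>D)"
      by simp
    \<comment> \<open>Quadratic growth holds pointwise; its lower bound is integrable, while the
      loss of \<open>w\<close> may have infinite expectation.\<close>
    also have "\<dots> \<le> ext_expectation D (\<lambda>x. L x (w x))"
    proof (rule integral_le_ext_expectation)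
      show "AE x in D. L x (wstar x) + \<mu> / 2 * (norm (wstar x - w x))\<^sup>2 \<le> L x (w x)"
      proof (rule AE_I2)
        fix x assume x: "x \<in> space D"
        show "L x (wstar x) + \<mu> / 2 * (norm (wstar x - w x))\<^sup>2 \<le> L x (w x)"
          using is_arg_min_strongly_convex_on_growth[OF convex_prob_simplex sc[OF x] min[OF x]
              w_in[OF x]]
          by (simp add: norm_minus_commute)
      qed
    qed (use Lint int_w Lmeas[OF wD] in auto)
    finally show ?thesis .
  qed
  \<comment> \<open>\<open>e\<close> is finite, so it can be moved across even when \<open>z\<close>
    is \<infinity>.\<close>
  have transfer: "ereal r \<le> z - ereal e" if "ereal (e + r) \<le> z" for r z
    using that by (cases z) auto
  have inf: "ereal (\<mu> / 2 * c)
      \<le> (INF w\<in>local_rules N s. ext_expectation D (\<lambda>x. L x (w x))) - ereal e"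
    using bound by (intro transfer INF_greatest)
  moreover have "0 < c" if nrec: "\<not> (\<exists>\<psi>\<in>borel_measurable N. AE x in D. wstar x = \<psi> (s x))"
  proof (rule ccontr)
    assume "\<not> 0 < c"
    moreover have "0 \<le> c"
      by (simp add: c_def)
    ultimately have "c = 0"
      by simp
    then have "AE x in D. (norm (wstar x - m x))\<^sup>2 = 0"
      using integral_nonneg_eq_0_iff_AE[OF int_m] by (simp add: c_def)
    then have "AE x in D. wstar x = m x"
      by simp
    \<comment> \<open>The factorization of \<open>m\<close> holds everywhere on
      \<open>space D\<close>; only \<open>wstar x = m x\<close> is almost sure.\<close>
    moreover obtain \<psi> where "\<psi> \<in> borel_measurable N" and \<psi>: "\<forall>x\<in>space D. m x = \<psi> (s x)"
      using Doob_Dynkin_vec[OF sX] m_measF unfolding F_def by blast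
    moreover have "AE x in D. m x = \<psi> (s x)"
      using \<psi> by (intro AE_I2) simp
    ultimately have "AE x in D. wstar x = \<psi> (s x)"
      by auto
    with \<open>\<psi> \<in> borel_measurable N\<close> nrec show False
      by blast
  qed
  \<comment> \<open>The single positive constant \<open>\<mu> / 2 * c\<close> bounds every rule's
    excess and the infimum, so both strict inequalities follow.\<close>
  moreover have "0 < z" if "0 < c" "ereal (\<mu> / 2 * c) \<le> z" for z
    using that \<mu> by (intro less_le_trans[of 0 "ereal (\<mu> / 2 * c)" z]) auto
  moreover have "ereal (\<mu> / 2 * c) \<le> ext_expectation D (\<lambda>x. L x (w x)) - ereal e"
    if "w \<in> local_rules N s" for w
    by (rule transfer[OF bound[OF that]])
  ultimately show ?thesis
    unfolding cv e by (intro conjI impI ballI) simp_all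
qed

end
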